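(* Let $X$ be a uniformly perfect complete metric space satisfying the finite doubling property. Then for each $\varepsilon>0$ there exists a measure $\mu$ supported on $X$ such that $\underline{\dim}_{\mathrm{reg}}(\mu) > \underline{\dim}_{\mathrm A}(X)-\varepsilon$ (if $\underline{\dim}_{\mathrm A}(X)=\infty$, this is understood as: for each real $t\ge 0$ there exists a measure $\mu$ supported on $X$ such that $\underline{\dim}_{\mathrm{reg}}(\mu)>t$).
   Context: Let $X=(X,d)$ be a metric space, always assumed to contain at least two points. Balls are closed: $B(x,r)=\{y\in X: d(x,y)\le r\}$. Finite doubling property: every ball $B(x,2r)\subset X$ can be covered by finitely many balls of radius $r$. Uniformly perfect: there is a constant $C\ge 1$ such that for every $x\in X$ and $r>0$ one has $B(x,r)\setminus B(x,r/C)\ne\emptyset$ whenever $X\setminus B(x,r)\neq\emptyset$. Lower dimension $\underline{\dim}_{\mathrm A}(X)$: the supremum of all $t\ge 0$ for which there is a constant $c>0$ such that, whenever $0<r<R<\operatorname{diam}(X)$ and $x\in X$, at least $c(r/R)^{-t}$ balls of radius $r$ are needed to cover $B(x,R)$. Measure: a nontrivial Borel regular outer measure on $X$ for which bounded sets have finite measure. A measure $\mu$ is supported on $X$ if its support is the whole of $X$, i.e. every ball of positive radius has positive measure. Lower regularity dimension $\underline{\dim}_{\mathrm{reg}}(\mu)$ (for $\mu$ supported on $X$): the supremum of all $t\ge0$ for which there is a constant $C\ge1$ such that $\frac{\mu(B(x,r))}{\mu(B(x,R))}\le C\left(\frac rR\right)^t$ whenever $x\in X$ and $0<r<R<\operatorname{diam}(X)$.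 *)

theory Defs
  imports "HOL-Analysis.Analysis"
begin

text \<open>
  The metric space \<open>X\<close> is the universe of a type of class \<^class>\<open>metric_space\<close>;
  balls are the closed balls \<^const>\<open>cball\<close>.
\<close>

definition finite_doubling :: "'a::metric_space itself \<Rightarrow> bool" where
  "finite_doubling T \<longleftrightarrow>
    (\<forall>(x::'a) r. 0 < r \<longrightarrow> (\<exists>F. finite F \<and> cball x (2 * r) \<subseteq> (\<Union>y\<in>F. cball y r)))"

definition uniformly_perfect :: "'a::metric_space itself \<Rightarrow> bool" where
  "uniformly_perfect T \<longleftrightarrow>
    (\<exists>C\<ge>1. \<forall>(x::'a) r. 0 < r \<longrightarrow> UNIV - cball x r \<noteq> {} \<longrightarrow> cball x r - cball x (r / C) \<noteq> {})"

text \<open>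
  The real-valued \<^const>\<open>diameter\<close> of an unbounded set is \<open>0\<close> by convention; here it has
  to be \<open>\<infinity>\<close>.
\<close>

definition ediameter :: "'a::metric_space set \<Rightarrow> ereal" where
  "ediameter S = (SUP (x, y)\<in>S \<times> S. ereal (dist x y))"

text \<open>
  In the lower dimension, a cover by balls of radius \<open>r\<close> is given by its set \<open>F\<close> of centres.
  Infinite covers satisfy any lower bound on the number of balls, so only finite ones are considered.
\<close>

definition lower_dim :: "'a::metric_space itself \<Rightarrow> ereal" where
  "lower_dim T = Sup {ereal t | t. 0 \<le> t \<and>
    (\<exists>c>0. \<forall>(x::'a) r R. 0 < r \<longrightarrow> r < R \<longrightarrow> ereal R < ediameter (UNIV :: 'a set) \<longrightarrow>
      (\<forall>F. finite F \<longrightarrow> cball x R \<subseteq> (\<Union>y\<in>F. cball y r) \<longrightarrow>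
        c * (r / R) powr (- t) \<le> real (card F)))}"

text \<open>
  Measures are outer measures, defined on all subsets. Borel regularity means that Borel sets are
  Caratheodory measurable and that every set lies in a Borel set of the same measure.
  \<^const>\<open>outer_measure_space\<close> asks for countable subadditivity only on disjoint families;
  on \<open>Pow UNIV\<close>, monotonicity extends it to all countable families.
\<close>

definition borel_regular :: "('a::topological_space set \<Rightarrow> ennreal) \<Rightarrow> bool" where
  "borel_regular \<mu> \<longleftrightarrow>
    sets borel \<subseteq> lambda_system UNIV (Pow UNIV) \<mu> \<and>
    (\<forall>A. \<exists>B\<in>sets borel. A \<subseteq> B \<and> \<mu> B = \<mu> A)"

definition metric_measure :: "('a::metric_space set \<Rightarrow> ennreal) \<Rightarrow> bool" where
  "metric_measure \<mu> \<longleftrightarrow>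
    outer_measure_space (Pow UNIV) \<mu> \<and> borel_regular \<mu> \<and>
    \<mu> UNIV \<noteq> 0 \<and> (\<forall>A. bounded A \<longrightarrow> \<mu> A < \<infinity>)"

definition fully_supported :: "('a::metric_space set \<Rightarrow> ennreal) \<Rightarrow> bool" where
  "fully_supported \<mu> \<longleftrightarrow> (\<forall>x r. 0 < r \<longrightarrow> 0 < \<mu> (cball x r))"

definition lower_reg_dim :: "('a::metric_space set \<Rightarrow> ennreal) \<Rightarrow> ereal" where
  "lower_reg_dim \<mu> = Sup {ereal t | t. 0 \<le> t \<and>
    (\<exists>C\<ge>1. \<forall>x r R. 0 < r \<longrightarrow> r < R \<longrightarrow> ereal R < ediameter (UNIV :: 'a set) \<longrightarrow>
      \<mu> (cball x r) / \<mu> (cball x R) \<le> ennreal (C * (r / R) powr t))}"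

end

theory Submission
  imports Defs
begin

text \<open>
  Below the lower dimension, every ball of radius \<open>\<rho>\<delta>\<^sup>k\<close> contains, for a suitable fixed \<open>\<delta>\<close>,
  at least \<open>N \<ge> \<delta>\<^sup>-\<^sup>s\<close> points, its centre among them, which are separated at scale \<open>\<rho>\<delta>\<^sup>k\<^sup>+\<^sup>1\<close>.
  Iterating this choice from a point \<open>x\<close> gives a Cantor set through \<open>x\<close> whose points are coded by
  the base \<open>N\<close> digits of a real parameter. The image of Lebesgue measure gives mass at most \<open>N\<^sup>-\<^sup>k\<close>
  to every ball at scale \<open>\<rho>\<delta>\<^sup>k\<close>, and about that much if the ball meets the Cantor set, so it satisfies
  the regularity inequality with exponent \<open>s\<close> and a constant independent of \<open>x\<close>. That inequality is
  linear in the measure, hence it survives a convergent superposition over a countable dense set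
  of points \<open>x\<close>, which has full support.
\<close>

section \<open>A Cantor measure through a prescribed point\<close>

text \<open>\<open>h k p d\<close> is the \<open>d\<close>-th child of \<open>p\<close> at level
  \<open>k\<close>; \<open>G k\<close> marks levels where siblings are separated. By
  \<open>D_good\<close> a nonzero index at level \<open>k\<close> forces separation one level up; by
  \<open>D_cell\<close> the domain \<open>D\<close> contains whole cells at good levels.\<close>

locale cantor_scheme =
  fixes N :: nat and \<delta> \<rho> :: real and h :: "int \<Rightarrow> 'a::complete_space \<Rightarrow> nat \<Rightarrow> 'a"
    and x0 :: 'a and G :: "int \<Rightarrow> bool" and D :: "real set"
  assumes N2: "2 \<le> N" and \<delta>_pos: "0 < \<delta>" and \<delta>_le: "\<delta> \<le> 1/2" and \<rho>_pos: "0 < \<rho>"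
    and D_borel: "D \<in> sets borel" and D_0: "0 \<in> D" and D_nonneg: "\<And>u. u \<in> D \<Longrightarrow> 0 \<le> u"
    and D_good: "\<And>u k. u \<in> D \<Longrightarrow> 1 \<le> u * N powr of_int k \<Longrightarrow> G (k - 1)"
    and D_cell: "\<And>u v k. u \<in> D \<Longrightarrow> G k \<Longrightarrow> 0 \<le> v \<Longrightarrow>
      \<lfloor>v * N powr of_int k\<rfloor> = \<lfloor>u * N powr of_int k\<rfloor> \<Longrightarrow> v \<in> D"
    and h_0: "\<And>k p. h k p 0 = p"
    and h_dist: "\<And>k p d. d < N \<Longrightarrow> dist (h k p d) p \<le> \<rho> * \<delta> powr of_int k"
    and h_sep: "\<And>k p d d'. G k \<Longrightarrow> d < N \<Longrightarrow> d' < N \<Longrightarrow> d \<noteq> d' \<Longrightarrow>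
      8 * (\<rho> * \<delta> powr of_int (k + 1)) < dist (h k p d) (h k p d')"
begin

section \<open>Digit coding of the Cantor set and convergence of the approximations\<close>

definition scale :: "int \<Rightarrow> real" where
  "scale k = \<rho> * \<delta> powr of_int k"

definition idx :: "int \<Rightarrow> real \<Rightarrow> nat" where
  "idx k u = nat \<lfloor>u * N powr of_int k\<rfloor>"

text \<open>The recursion runs over the index and not over the level, since the levels are all
  integers and need have no coarsest one. It stops at index 0, whose ancestors all have index 0 and
  sit at \<open>x0\<close>.\<close>

function node :: "int \<Rightarrow> nat \<Rightarrow> 'a" where
  "node k i = (if i = 0 then x0 else h (k - 1) (node (k - 1) (i div N)) (i mod N))"
  by auto
termination
  using N2 by (relation "Wellfounded.measure snd") auto

declare node.simps [simp del]

definition approx :: "int \<Rightarrow> real \<Rightarrow> 'a" where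
  "approx k u = node k (idx k u)"

definition point :: "real \<Rightarrow> 'a" where
  "point u = lim (\<lambda>n. approx (int n) u)"

definition cantor_measure :: "'a measure" where
  "cantor_measure = distr (restrict_space lborel D) borel point"

lemma scale_pos: "0 < scale k"
  using \<rho>_pos \<delta>_pos by (simp add: scale_def)

lemma scale_step: "scale (k + 1) = \<delta> * scale k"
  using \<delta>_pos by (simp add: scale_def powr_add)

lemma scale_half: "scale (k + 1) \<le> scale k / 2"
  using \<delta>_le scale_pos[of k] mult_right_mono[of \<delta> "1/2" "scale k"] by (simp add: scale_step)

text \<open>The floor of \<open>y / N\<close> depends only on the floor of \<open>y\<close>, so the
  parent cell is found by dropping the last base \<open>N\<close> digit.\<close>

lemma idx_div: "0 \<le> u \<Longrightarrow> idx (k + 1) u div N = idx k u"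
proof -
  assume u: "0 \<le> u"
  have "u * N powr of_int k = u * N powr of_int (k + 1) / real_of_int (int N)"
    using N2 by (simp add: powr_add)
  then have "\<lfloor>u * N powr of_int k\<rfloor> = \<lfloor>u * N powr of_int (k + 1)\<rfloor> div int N"
    by (metis floor_divide_real_eq_div of_nat_0_le_iff)
  then show ?thesis
    unfolding idx_def using u by (simp add: nat_div_distrib)
qed

text \<open>\<open>h_0\<close> makes the recursion valid at index 0 as well: child 0 of
  \<open>x0\<close> is \<open>x0\<close> again.\<close>

lemma node_step: "node (k + 1) i = h k (node k (i div N)) (i mod N)"
  by (subst node.simps) (auto simp: h_0 node.simps[of _ 0])

lemma approx_step: "0 \<le> u \<Longrightarrow> approx (k + 1) u = h k (approx k u) (idx (k + 1) u mod N)"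
  unfolding approx_def by (subst node_step) (simp add: idx_div)

lemma approx_dist_step: "0 \<le> u \<Longrightarrow> dist (approx (k + 1) u) (approx k u) \<le> scale k"
  using N2 h_dist by (simp add: approx_step scale_def)

text \<open>The subtracted term keeps the induction going: the next step costs
  \<open>scale (k + int n)\<close>, and the scales at least halve.\<close>

lemma approx_dist_add:
  assumes "0 \<le> u"
  shows "dist (approx (k + int n) u) (approx k u) \<le> 2 * scale k - 2 * scale (k + int n)"
proof (induction n)
  case 0
  then show ?case by simp
next
  case (Suc n)
  have eq: "k + int (Suc n) = (k + int n) + 1" by simp
  show ?case
    unfolding eq
    using Suc approx_dist_step[OF assms, of "k + int n"] scale_half[of "k + int n"]
      dist_triangle[of "approx (k + int n + 1) u" "approx k u" "approx (k + int n) u"]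
    by linarith
qed

lemma approx_dist:
  assumes "0 \<le> u" "k \<le> m"
  shows "dist (approx m u) (approx k u) \<le> 2 * scale k"
  using approx_dist_add[OF assms(1), of k "nat (m - k)"] assms(2) scale_pos[of m] by simp

lemma scale_tendsto: "(\<lambda>n. scale (int n)) \<longlonglongrightarrow> 0"
proof -
  have "scale (int n) = \<rho> * \<delta> ^ n" for n
    using \<delta>_pos by (simp add: scale_def powr_realpow)
  then show ?thesis
    using \<delta>_pos \<delta>_le by (auto intro!: tendsto_mult_right_zero LIMSEQ_power_zero)
qed

lemma approx_tendsto:
  assumes "0 \<le> u"
  shows "(\<lambda>n. approx (int n) u) \<longlonglongrightarrow> point u"
proof -
  have "Cauchy (\<lambda>n. approx (int n) u)"
  proof (rule metric_CauchyI)
    fix e :: real assume "0 < e"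
    then obtain n0 where n0: "\<And>n. n0 \<le> n \<Longrightarrow> \<bar>scale (int n)\<bar> < e / 4"
      using LIMSEQ_D[OF scale_tendsto, of "e/4"] by auto
    have "dist (approx (int m) u) (approx (int n) u) < e" if "n0 \<le> m" "n0 \<le> n" for m n
      using approx_dist[OF assms, of "int n0" "int m"] approx_dist[OF assms, of "int n0" "int n"]
        n0[of n0] that dist_triangle2[of "approx (int m) u" "approx (int n) u" "approx (int n0) u"]
      by auto
    then show "\<exists>M. \<forall>m\<ge>M. \<forall>n\<ge>M. dist (approx (int m) u) (approx (int n) u) < e" by blast
  qed
  then show ?thesis
    unfolding point_def using Cauchy_convergent convergent_LIMSEQ_iff by blast
qed

lemma point_dist:
  assumes "0 \<le> u"
  shows "dist (point u) (approx k u) \<le> 2 * scale k"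
proof (rule tendsto_upperbound)
  show "(\<lambda>n. dist (approx (int n) u) (approx k u)) \<longlonglongrightarrow> dist (point u) (approx k u)"
    by (intro tendsto_intros approx_tendsto assms)
  show "\<forall>\<^sub>F n in sequentially. dist (approx (int n) u) (approx k u) \<le> 2 * scale k"
    using approx_dist[OF assms, of k] by (intro eventually_sequentiallyI[of "nat k"]) auto
qed auto

text \<open>All digits of the parameter 0 vanish, so \<open>x0\<close> belongs to the Cantor set;
  this is what gives mass to balls about \<open>x0\<close>.\<close>

lemma point_0: "point 0 = x0"
proof -
  have "approx k 0 = x0" for k by (simp add: approx_def idx_def node.simps)
  then show ?thesis using approx_tendsto[of 0] by (simp add: LIMSEQ_const_iff)
qed

text \<open>
  Separation of siblings makes the parent map injective on the cells near \<open>x\<close>, and iterating it sends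
  every cell to cell 0.
\<close>

lemma idx_unique:
  assumes "u \<in> D" "v \<in> D"
    and "dist (approx k u) x \<le> 4 * scale k" "dist (approx k v) x \<le> 4 * scale k"
  shows "idx k u = idx k v"
  using assms(3,4)
proof (induction "max (idx k u) (idx k v)" arbitrary: k rule: less_induct)
  case less
  show ?case
  proof (rule ccontr)
    assume ne: "idx k u \<noteq> idx k v"
    have uv: "0 \<le> u" "0 \<le> v" using assms D_nonneg by auto
    define j where "j = k - 1"
    have k: "k = j + 1" by (simp add: j_def)
    have "0 < idx k u \<or> 0 < idx k v" using ne by auto
    \<comment> \<open>One of two different indices is nonzero, so its parameter satisfies the
      premise of \<open>D_good\<close>.\<close>
    then have G: "G j"
      unfolding j_def using D_good[of u k] D_good[of v k] assms(1,2)
      by (auto simp: idx_def)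
    have divs: "idx j u = idx k u div N" "idx j v = idx k v div N"
      unfolding k using idx_div uv by auto
    have "max (idx k u) (idx k v) div N < max (idx k u) (idx k v)"
      using ne N2 by (intro div_less_dividend) auto
    moreover have "idx j u \<le> max (idx k u) (idx k v) div N" "idx j v \<le> max (idx k u) (idx k v) div N"
      unfolding divs by (intro div_le_mono max.cobounded1 max.cobounded2)+
    ultimately have "max (idx j u) (idx j v) < max (idx k u) (idx k v)"
      unfolding max_less_iff_conj by linarith
    \<comment> \<open>Going up a level costs at most \<open>scale j\<close>, and
      \<open>4 * scale k\<close> is at most \<open>2 * scale j\<close>, so the total factor 3 stays
      below 4.\<close>
    moreover have "dist (approx j w) x \<le> 4 * scale j" if "0 \<le> w" "dist (approx k w) x \<le> 4 * scale k" for w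
      using approx_dist_step[OF that(1), of j] that(2) scale_half[of j] scale_pos[of j]
        dist_triangle[of "approx j w" x "approx k w"] unfolding k
      by (simp add: dist_commute)
    ultimately have eq: "idx j u = idx j v"
      using less.hyps[of j] less.prems uv by simp
    then have "approx j u = approx j v" by (simp add: approx_def)
    moreover have "idx k u mod N \<noteq> idx k v mod N"
      using ne eq divs by (metis div_mult_mod_eq)
    ultimately have "8 * scale k < dist (approx k u) (approx k v)"
      unfolding k approx_step[OF uv(1)] approx_step[OF uv(2)] scale_def
      using h_sep[OF G] N2 by simp
    \<comment> \<open>Both nodes lie within \<open>4 * scale k\<close> of \<open>x\<close>, hence at
      most \<open>8 * scale k\<close> apart: the origin of the factor 8 in
      \<open>h_sep\<close>.\<close>
    then show False
      using less.prems dist_triangle2[of "approx k u" "approx k v" x] by linarith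
  qed
qed

section \<open>Mass of balls under the Cantor measure\<close>

lemma point_measurable [measurable]: "point \<in> restrict_space lborel D \<rightarrow>\<^sub>M borel"
proof (rule borel_measurable_LIMSEQ_metric)
  fix n
  \<comment> \<open>Each approximation factors through a discrete index, so it is measurable
    whatever \<open>node\<close> does.\<close>
  have "(\<lambda>u. node (int n) (nat \<lfloor>u * N powr of_int (int n)\<rfloor>)) \<in> lborel \<rightarrow>\<^sub>M borel"
    by (rule measurable_compose[of _ _ "count_space UNIV"]) measurable
  then show "approx (int n) \<in> restrict_space lborel D \<rightarrow>\<^sub>M borel"
    unfolding approx_def idx_def by (intro measurable_restrict_space1)
qed (auto intro!: approx_tendsto D_nonneg simp: space_restrict_space)

lemma sets_cantor [simp]: "sets cantor_measure = sets borel"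
  by (simp add: cantor_measure_def)

lemma emeasure_cantor:
  assumes "A \<in> sets borel"
  shows "emeasure cantor_measure A = emeasure lborel {u \<in> D. point u \<in> A}"
proof -
  have D: "D \<inter> space lborel \<in> sets lborel" using D_borel by simp
  have "point -` A \<inter> D = {u \<in> D. point u \<in> A}" by auto
  then show ?thesis
    using assms emeasure_restrict_space[OF D]
    by (simp add: cantor_measure_def emeasure_distr space_restrict_space)
qed

lemma idx_cell:
  assumes "0 \<le> v"
  shows "idx k v = i \<longleftrightarrow> v \<in> {i * N powr of_int (- k) ..< i * N powr of_int (- k) + N powr of_int (- k)}"
proof -
  have N: "0 < N powr of_int k" using N2 by simp
  have "idx k v = i \<longleftrightarrow> \<lfloor>v * N powr of_int k\<rfloor> = int i"
    using assms by (auto simp: idx_def)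
  also have "\<dots> \<longleftrightarrow> i / N powr of_int k \<le> v \<and> v < (1 + i) / N powr of_int k"
    using N by (simp add: floor_eq_iff pos_divide_le_eq pos_less_divide_eq add.commute)
  finally show ?thesis
    by (simp add: powr_minus divide_inverse distrib_right add.commute)
qed

text \<open>If \<open>point w\<close> lies in the ball, the level \<open>k\<close> approximation is
  within \<open>2 * scale k + 2 * scale k\<close> of \<open>x\<close>. By \<open>idx_unique\<close>
  all such parameters share one cell, an interval of length
  \<open>N powr of_int (- k)\<close>.\<close>

lemma cantor_upper:
  assumes "r \<le> 2 * scale k"
  shows "emeasure cantor_measure (cball x r) \<le> ennreal (N powr of_int (- k))"
proof (cases "\<exists>u\<in>D. point u \<in> cball x r")
  case True
  then obtain u where u: "u \<in> D" "point u \<in> cball x r" by auto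
  have near: "dist (approx k w) x \<le> 4 * scale k" if "w \<in> D" "point w \<in> cball x r" for w
    using point_dist[OF D_nonneg[OF that(1)], of k] that(2) assms
      dist_triangle[of "approx k w" x "point w"] by (simp add: dist_commute)
  let ?a = "idx k u * N powr of_int (- k)"
  have "{w \<in> D. point w \<in> cball x r} \<subseteq> {?a ..< ?a + N powr of_int (- k)}"
    using idx_unique[OF _ u(1) near near[OF u]] idx_cell D_nonneg by blast
  then have "emeasure lborel {w \<in> D. point w \<in> cball x r} \<le> emeasure lborel {?a ..< ?a + N powr of_int (- k)}"
    by (intro emeasure_mono) auto
  then show ?thesis by (simp add: emeasure_cantor)
next
  case False
  then have none: "{w \<in> D. point w \<in> cball x r} = {}" by auto
  show ?thesis unfolding emeasure_cantor[OF borel_closed[OF closed_cball]] none by simp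
qed

text \<open>The whole level \<open>k\<close> cell of \<open>u\<close> lies in \<open>D\<close>
  because the level is good, and its points share an approximation with \<open>point u\<close>,
  hence are within \<open>4 * scale k\<close> of it.\<close>

lemma cantor_lower:
  assumes "u \<in> D" "G k" "dist (point u) x + 4 * scale k \<le> R"
  shows "ennreal (N powr of_int (- k)) \<le> emeasure cantor_measure (cball x R)"
proof -
  let ?a = "idx k u * N powr of_int (- k)"
  have "{?a ..< ?a + N powr of_int (- k)} \<subseteq> {w \<in> D. point w \<in> cball x R}"
  proof
    fix v assume v: "v \<in> {?a ..< ?a + N powr of_int (- k)}"
    then have v0: "0 \<le> v" by (auto intro: order_trans[rotated])
    then have eq: "idx k v = idx k u" using idx_cell v by blast
    then have "\<lfloor>v * N powr of_int k\<rfloor> = \<lfloor>u * N powr of_int k\<rfloor>"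
      using v0 D_nonneg[OF assms(1)] unfolding idx_def by (subst (asm) eq_nat_nat_iff) simp_all
    then have "v \<in> D" by (rule D_cell[OF assms(1,2) v0])
    moreover have "approx k v = approx k u" by (simp add: approx_def eq)
    then have "dist x (point v) \<le> R"
      using point_dist[OF v0, of k] point_dist[OF D_nonneg[OF assms(1)], of k] assms(3)
        dist_triangle[of x "point v" "point u"] dist_triangle2[of "point u" "point v" "approx k u"]
      by (simp add: dist_commute)
    ultimately show "v \<in> {w \<in> D. point w \<in> cball x R}" by simp
  qed
  moreover have "{w \<in> D. point w \<in> cball x R} \<in> sets lborel"
    using measurable_sets[OF point_measurable, of "cball x R"] D_borel
    by (auto simp: sets_restrict_space_iff space_restrict_space vimage_def Int_def conj_commute)
  ultimately have "emeasure lborel {?a ..< ?a + N powr of_int (- k)} \<le> emeasure lborel {w \<in> D. point w \<in> cball x R}"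
    by (intro emeasure_mono) auto
  then show ?thesis by (simp add: emeasure_cantor)
qed

text \<open>The level is minus the floor of the logarithm of \<open>y / \<rho>\<close> to the base
  \<open>1 / \<delta>\<close>.\<close>

lemma scale_between:
  assumes "0 < y"
  obtains k where "scale k \<le> y" "y < scale (k - 1)"
proof -
  let ?j = "\<lfloor>log (1/\<delta>) (y / \<rho>)\<rfloor>"
  have "(1/\<delta>) powr ?j \<le> y / \<rho> \<and> y / \<rho> < (1/\<delta>) powr (?j + 1)"
    using floor_log_eq_powr_iff[of "y / \<rho>" "1/\<delta>" ?j] assms \<rho>_pos \<delta>_pos \<delta>_le by simp
  moreover have "(1/\<delta>) powr a = \<delta> powr (- a)" for a
    using \<delta>_pos by (simp add: powr_divide powr_minus_divide)
  ultimately have "\<delta> powr of_int (- ?j) \<le> y / \<rho>" "y / \<rho> < \<delta> powr of_int (- ?j - 1)"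
    by auto
  then have "scale (- ?j) \<le> y" "y < scale (- ?j - 1)"
    unfolding scale_def using \<rho>_pos by (simp_all add: field_simps)
  then show ?thesis using that by blast
qed

text \<open>The bound depends on neither \<open>x0\<close> nor \<open>x\<close>, so one function of
  \<open>r\<close> serves all Cantor measures in the superposition. \<open>SOME\<close> picks any
  sufficiently coarse level.\<close>

lemma cantor_finite:
  "emeasure cantor_measure (cball x r) \<le> ennreal (N powr of_int (- (SOME k. r \<le> 2 * (\<rho> * \<delta> powr of_int k))))"
proof -
  obtain k where "max 1 r / 2 < scale (k - 1)"
    by (rule scale_between[of "max 1 r / 2"]) auto
  then have "\<exists>k. r \<le> 2 * (\<rho> * \<delta> powr of_int k)"
    unfolding scale_def by (intro exI[of _ "k - 1"]) auto
  from someI_ex[OF this] show ?thesis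
    by (intro cantor_upper) (simp add: scale_def)
qed

text \<open>A sufficiently fine level is good and has \<open>4 * scale k \<le> r\<close>; the cell
  of the parameter 0 is then mapped into the ball.\<close>

lemma cantor_pos:
  assumes good: "\<And>k. ereal (8 * scale k) < ediameter (UNIV :: 'a set) \<Longrightarrow> G k"
    and diam: "0 < ediameter (UNIV :: 'a set)" and r: "0 < r"
  shows "0 < emeasure cantor_measure (cball x0 r)"
proof -
  obtain d where d: "0 < d" "ereal d < ediameter (UNIV :: 'a set)"
    using ereal_dense2[OF diam] by (auto simp: zero_ereal_def)
  obtain k where k: "scale k \<le> min d r / 8"
    using scale_between[of "min d r / 8"] d r by auto
  then have "ereal (8 * scale k) \<le> ereal d" by simp
  then have "G k" using d(2) by (intro good) (rule le_less_trans)
  then have "ennreal (N powr of_int (- k)) \<le> emeasure cantor_measure (cball x0 r)"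
    using k scale_pos[of k] by (intro cantor_lower[OF D_0]) (auto simp: point_0)
  moreover have "0 < ennreal (N powr of_int (- k))" using N2 by simp
  ultimately show ?thesis by (rule less_le_trans[rotated])
qed

text \<open>Comparable radii are absorbed by the constant, and a ball missing the Cantor set is
  null. Otherwise \<open>r\<close> and \<open>R\<close> correspond to levels \<open>m\<close> and
  \<open>k\<close> with \<open>k \<le> m\<close>, and \<open>N_large\<close> turns the mass ratio
  \<open>N powr of_int (k - m)\<close> into a power of
  \<open>\<delta> powr of_int (m - k)\<close>.\<close>

lemma cantor_decay:
  assumes good: "\<And>k. ereal (8 * scale k) < ediameter (UNIV :: 'a set) \<Longrightarrow> G k"
    and s: "0 \<le> s" and N_large: "1 / N \<le> \<delta> powr s"
    and r: "0 < r" "r < R" "ereal R < ediameter (UNIV :: 'a set)"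
  shows "emeasure cantor_measure (cball x r) \<le>
    ennreal ((4 / \<delta>\<^sup>2) powr s * (r / R) powr s) * emeasure cantor_measure (cball x R)"
proof (cases "\<delta> / 4 * R < r")
  case True
  have "1 \<le> 4 / \<delta>\<^sup>2 * (r / R)"
  proof -
    have "\<delta>\<^sup>2 * R \<le> \<delta> * R"
      using \<delta>_pos \<delta>_le r by (simp add: power2_eq_square mult_le_cancel_right)
    also have "\<dots> \<le> 4 * r" using True by simp
    finally show ?thesis using \<delta>_pos r by (simp add: field_simps)
  qed
  then have "1 \<le> (4 / \<delta>\<^sup>2 * (r / R)) powr s" using s by (rule ge_one_powr_ge_zero)
  also have "\<dots> = (4 / \<delta>\<^sup>2) powr s * (r / R) powr s"
    by (rule powr_mult)
  finally have "ennreal 1 \<le> ennreal ((4 / \<delta>\<^sup>2) powr s * (r / R) powr s)" by (rule ennreal_leI)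
  moreover have "emeasure cantor_measure (cball x r) \<le> emeasure cantor_measure (cball x R)"
    using r by (intro emeasure_mono) auto
  ultimately show ?thesis by (metis ennreal_1 mult_1 mult_mono zero_le)
next
  case small: False
  show ?thesis
  proof (cases "\<exists>u\<in>D. point u \<in> cball x r")
    case False
    then have none: "{w \<in> D. point w \<in> cball x r} = {}" by auto
    show ?thesis unfolding emeasure_cantor[OF borel_closed[OF closed_cball]] none by simp
  next
    case True
    then obtain u where u: "u \<in> D" "dist (point u) x \<le> r" by (auto simp: dist_commute)
    \<comment> \<open>The division by 8 yields \<open>8 * scale k \<le> R\<close>, which makes level
      \<open>k\<close> good and leaves room for \<open>cantor_lower\<close>.\<close>
    obtain k where k: "scale k \<le> R / 8" "R / 8 < scale (k - 1)"
      using scale_between[of "R / 8"] r by auto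
    \<comment> \<open>The bracketing level is named \<open>m + 1\<close>, so that
      \<open>r < 2 * scale m\<close>, as \<open>cantor_upper\<close> needs.\<close>
    obtain m where m: "scale (m + 1) \<le> r / 2" "r / 2 < scale m"
      using scale_between[of "r / 2"] r by (metis diff_add_cancel half_gt_zero)
    have "ereal (8 * scale k) \<le> ereal R" using k by simp
    then have "G k" using r(3) by (intro good) (rule le_less_trans)
    \<comment> \<open>The exponent is \<open>(m + 1) - (k - 1)\<close>: level \<open>m + 1\<close>
      bounds \<open>r / 2\<close> from below, level \<open>k - 1\<close> bounds \<open>R / 8\<close>
      from above.\<close>
    have quot: "\<delta> powr of_int (m - k + 2) < 4 * (r / R)"
    proof -
      have "\<delta> powr of_int (m - k + 2) = scale (m + 1) / scale (k - 1)"
        unfolding scale_def using \<rho>_pos by (simp add: powr_diff[symmetric] algebra_simps)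
      also have "\<dots> \<le> (r / 2) / scale (k - 1)"
        using m scale_pos by (intro divide_right_mono) (auto intro: less_imp_le)
      also have "\<dots> < (r / 2) / (R / 8)"
        using k r by (intro divide_strict_left_mono) auto
      finally show ?thesis by (simp add: field_simps)
    qed
    moreover have "4 * (r / R) \<le> \<delta>" using small r by (simp add: field_simps)
    ultimately have "\<delta> powr of_int (m - k + 2) < \<delta> powr 1" using \<delta>_pos by simp
    moreover have "\<delta> powr 1 \<le> \<delta> powr of_int (m - k + 2)" if "m < k"
      using that \<delta>_pos \<delta>_le by (intro powr_mono') linarith+
    ultimately have "k \<le> m" by linarith
    have "\<delta> powr of_int (m - k) = \<delta> powr of_int (m - k + 2) / \<delta>\<^sup>2"
      using \<delta>_pos by (simp add: powr_add)
    also have "\<dots> \<le> 4 * (r / R) / \<delta>\<^sup>2"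
      using quot by (intro divide_right_mono) auto
    finally have quot2: "\<delta> powr of_int (m - k) \<le> 4 / \<delta>\<^sup>2 * (r / R)"
      by (simp add: mult.commute)
    have "N powr of_int (- m) = (1 / N) powr of_int (m - k) * N powr of_int (- k)"
      using N2 by (simp add: powr_divide powr_diff powr_minus field_simps)
    also have "(1 / N) powr of_int (m - k) \<le> (\<delta> powr s) powr of_int (m - k)"
      using \<open>k \<le> m\<close> N_large by (intro powr_mono2) auto
    also have "\<dots> = (\<delta> powr of_int (m - k)) powr s"
      by (simp add: powr_powr mult.commute)
    also have "\<dots> \<le> (4 / \<delta>\<^sup>2 * (r / R)) powr s"
      using quot2 s by (intro powr_mono2) auto
    also have "\<dots> = (4 / \<delta>\<^sup>2) powr s * (r / R) powr s"
      by (rule powr_mult)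
    finally have "N powr of_int (- m) \<le> (4 / \<delta>\<^sup>2) powr s * (r / R) powr s * N powr of_int (- k)"
      by (simp add: mult_right_mono)
    then have "ennreal (N powr of_int (- m)) \<le> ennreal ((4 / \<delta>\<^sup>2) powr s * (r / R) powr s) * ennreal (N powr of_int (- k))"
      by (simp add: ennreal_mult[symmetric] ennreal_leI)
    moreover have "emeasure cantor_measure (cball x r) \<le> ennreal (N powr of_int (- m))"
      using m by (intro cantor_upper) simp
    moreover have "ennreal (N powr of_int (- k)) \<le> emeasure cantor_measure (cball x R)"
    proof (rule cantor_lower[OF u(1) \<open>G k\<close>])
      \<comment> \<open>The sum is at most \<open>R / 8 + R / 2\<close>.\<close>
      have "\<delta> / 4 * R \<le> 1 / 8 * R" using \<delta>_le r by (intro mult_right_mono) auto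
      then show "dist (point u) x + 4 * scale k \<le> R" using u(2) k small r by linarith
    qed
    ultimately show ?thesis
      by (meson mult_left_mono order_trans zero_le)
  qed
qed

end

section \<open>Existence of the scheme\<close>

text \<open>Greedy choice from the centre: balls of radius \<open>S\<close> about fewer than
  \<open>n\<close> chosen points cannot cover, and any uncovered point can be added.\<close>

lemma separated_points:
  fixes p :: "'a::metric_space"
  assumes "0 \<le> R" "1 \<le> n"
    and cover: "\<And>F. finite F \<Longrightarrow> card F < n \<Longrightarrow> \<not> cball p R \<subseteq> (\<Union>y\<in>F. cball y S)"
  shows "\<exists>e. e 0 = p \<and> (\<forall>d<n. dist (e d) p \<le> R) \<and>
    (\<forall>d<n. \<forall>d'<n. d \<noteq> d' \<longrightarrow> S < dist (e d) (e d'))"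
  using assms(2,3)
proof (induction n rule: nat_induct_at_least)
  case base
  show ?case using assms(1) by (intro exI[of _ "\<lambda>_. p"]) auto
next
  case (Suc n)
  then obtain e where e: "e 0 = p" "\<And>d. d < n \<Longrightarrow> dist (e d) p \<le> R"
    "\<And>d d'. d < n \<Longrightarrow> d' < n \<Longrightarrow> d \<noteq> d' \<Longrightarrow> S < dist (e d) (e d')"
    by (metis less_SucI)
  have "card (e ` {..<n}) \<le> card {..<n}" by (rule card_image_le) simp
  then obtain y where y: "y \<in> cball p R" "y \<notin> (\<Union>z\<in>e ` {..<n}. cball z S)"
    using Suc.prems[of "e ` {..<n}"] by fastforce
  then have "\<And>d. d < n \<Longrightarrow> S < dist (e d) y" by (auto simp: not_le)
  then show ?case
    using e y(1) Suc.hyps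
    by (intro exI[of _ "e(n := y)"]) (auto simp: dist_commute less_Suc_eq)
qed

lemma ediameter_pos:
  assumes "\<exists>x y :: 'a::metric_space. x \<noteq> y"
  shows "0 < ediameter (UNIV :: 'a set)"
proof -
  obtain x y :: 'a where "x \<noteq> y" using assms by blast
  then have "0 < ereal (dist x y)" by simp
  also have "\<dots> \<le> ediameter (UNIV :: 'a set)"
    unfolding ediameter_def by (rule SUP_upper2[of "(x, y)"]) auto
  finally show ?thesis .
qed

text \<open>
  For unbounded spaces the Cantor set has no coarsest level: the levels are all of \<open>\<int>\<close> and the
  parameter domain is a half-line.
\<close>

lemma domain_exists:
  fixes N :: nat and \<delta> :: real and diam :: ereal
  assumes "0 < diam" "2 \<le> N" "0 < \<delta>" "\<delta> \<le> 1/2"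
  obtains \<rho> :: real and D :: "real set" and G :: "int \<Rightarrow> bool"
  where "0 < \<rho>" "D \<in> sets borel" "0 \<in> D" "\<And>u. u \<in> D \<Longrightarrow> 0 \<le> u"
    "\<And>u k. u \<in> D \<Longrightarrow> 1 \<le> u * N powr of_int k \<Longrightarrow> G (k - 1)"
    "\<And>u v k. u \<in> D \<Longrightarrow> G k \<Longrightarrow> 0 \<le> v \<Longrightarrow>
      \<lfloor>v * N powr of_int k\<rfloor> = \<lfloor>u * N powr of_int k\<rfloor> \<Longrightarrow> v \<in> D"
    "\<And>k. G k \<Longrightarrow> ereal (\<rho> * \<delta> powr of_int k) < diam"
    "\<And>k. ereal (8 * (\<rho> * \<delta> powr of_int k)) < diam \<Longrightarrow> G k"
proof (cases "diam = \<infinity>")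
  case True
  show ?thesis
    by (rule that[of 1 "{0..}" "\<lambda>_. True"]) (use True in auto)
next
  case False
  then obtain d where d: "diam = ereal d" "0 < d"
    using assms(1) by (cases diam) auto
  have N: "1 < real N" using assms by simp
  \<comment> \<open>With \<open>d / 2\<close> as base scale, level 0 is strictly below the diameter
    \<open>d\<close>, while eight times the scale of a negative level exceeds \<open>d\<close>. So
    taking the nonnegative levels as good meets both demands on \<open>G\<close>.\<close>
  show ?thesis
  proof (rule that[of "d/2" "{0..<1}" "\<lambda>k. 0 \<le> k"])
    fix u :: real and k :: int
    assume u: "u \<in> {0..<1}" "1 \<le> u * N powr of_int k"
    then have "u * N powr of_int k < 1 * N powr of_int k"
      using N by (intro mult_strict_right_mono) auto
    then have "1 < N powr of_int k" using u(2) by linarith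
    then have "N powr 0 < N powr of_int k" using N by simp
    then show "0 \<le> k - 1" using N by (subst (asm) powr_less_cancel_iff) auto
  next
    fix u v :: real and k :: int
    assume *: "u \<in> {0..<1}" "0 \<le> k" "0 \<le> v" "\<lfloor>v * N powr of_int k\<rfloor> = \<lfloor>u * N powr of_int k\<rfloor>"
    \<comment> \<open>At a nonnegative level this power is an integer, so being below it passes from
      \<open>u\<close> to the common floor and on to \<open>v\<close>.\<close>
    have p: "N powr of_int k = of_int (int N ^ nat k)"
      using *(2) N by (simp add: powr_real_of_int)
    have "u * N powr of_int k < 1 * N powr of_int k"
      using * N by (intro mult_strict_right_mono) auto
    then have "\<lfloor>u * N powr of_int k\<rfloor> < int N ^ nat k"
      unfolding floor_less_iff p[symmetric] by simp
    then have "v * N powr of_int k < 1 * N powr of_int k"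
      unfolding *(4)[symmetric] floor_less_iff p[symmetric] by simp
    then show "v \<in> {0..<1}" using *(3) N by simp
  next
    fix k :: int assume "0 \<le> k"
    then have "\<delta> powr of_int k \<le> 1" using assms by (intro powr_le1) auto
    then have "d / 2 * \<delta> powr of_int k \<le> d / 2 * 1" using d by (intro mult_left_mono) auto
    then show "ereal (d / 2 * \<delta> powr of_int k) < diam" using d by simp
  next
    fix k :: int assume *: "ereal (8 * (d / 2 * \<delta> powr of_int k)) < diam"
    show "0 \<le> k"
    proof (rule ccontr)
      assume "\<not> 0 \<le> k"
      then have "\<delta> powr 0 \<le> \<delta> powr of_int k"
        using assms by (intro powr_mono') auto
      then have "d * 1 \<le> d * \<delta> powr of_int k"
        using assms(3) d by (intro mult_left_mono) auto
      then show False using * d by simp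
    qed
  qed (use d in auto)
qed

text \<open>The regularity inequality is multiplied out: this form is linear in \<open>M\<close> and
  needs no positive denominator.\<close>

definition decays :: "real \<Rightarrow> real \<Rightarrow> 'a::metric_space measure \<Rightarrow> bool" where
  "decays s C M \<longleftrightarrow> (\<forall>x r R. 0 < r \<longrightarrow> r < R \<longrightarrow> ereal R < ediameter (UNIV :: 'a set) \<longrightarrow>
    emeasure M (cball x r) \<le> ennreal (C * (r / R) powr s) * emeasure M (cball x R))"

text \<open>\<open>N\<close> has to fit between \<open>\<delta> powr (- s)\<close> and
  \<open>c * (8 * \<delta>) powr (- t)\<close>. Since \<open>s < t\<close>, the gap opens as
  \<delta> tends to 0.\<close>

lemma scheme_constants:
  fixes c s t :: real
  assumes "0 < c" "0 < s" "s < t"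
  obtains \<delta> :: real and N :: nat
  where "0 < \<delta>" "\<delta> \<le> 1/2" "8 * \<delta> < 1" "2 \<le> N" "1 / N \<le> \<delta> powr s" "N \<le> c * (8 * \<delta>) powr (- t)"
proof -
  \<comment> \<open>The value of \<open>\<delta> powr (t - s)\<close> at which
    \<open>2 * \<delta> powr (- s)\<close> meets the upper bound; the factor 2 absorbs the rounding
    in \<open>N\<close>.\<close>
  define A where "A = c * 8 powr (- t) / 2"
  define \<delta> where "\<delta> = min (1/16) (A powr (1 / (t - s)))"
  define N where "N = nat \<lceil>\<delta> powr (- s)\<rceil>"
  have A: "0 < A" using assms by (simp add: A_def)
  have \<delta>: "0 < \<delta>" "\<delta> \<le> 1/16" using A by (auto simp: \<delta>_def)
  have "\<delta> powr (t - s) \<le> (A powr (1 / (t - s))) powr (t - s)"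
    using \<delta> assms by (intro powr_mono2) (auto simp: \<delta>_def)
  also have "\<dots> = A" using A assms by (simp add: powr_powr)
  finally have *: "\<delta> powr (t - s) \<le> A" .
  have gt1: "1 < \<delta> powr (- s)"
    using \<delta> assms powr_less_mono'[of \<delta> "-s" 0] by simp
  then have N2: "2 \<le> N" unfolding N_def by linarith
  have lo: "\<delta> powr (- s) \<le> N" unfolding N_def by linarith
  have hi: "N \<le> 2 * \<delta> powr (- s)" unfolding N_def using gt1 by linarith
  have "2 * \<delta> powr (- s) = 2 * \<delta> powr (t - s) * \<delta> powr (- t)"
    using \<delta> by (simp add: powr_add[symmetric])
  also have "\<dots> \<le> 2 * A * \<delta> powr (- t)"
    using * by (intro mult_right_mono) auto
  also have "\<dots> = c * (8 * \<delta>) powr (- t)"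
    using \<delta> by (simp add: A_def powr_mult)
  finally have "N \<le> c * (8 * \<delta>) powr (- t)" using hi by linarith
  moreover have "1 / N \<le> \<delta> powr s"
    using lo N2 \<delta> by (simp add: powr_minus field_simps)
  ultimately show ?thesis using that[of \<delta> N] \<delta> N2 by simp
qed

text \<open>\<open>C\<close> and \<open>b\<close> are quantified before \<open>x0\<close>: the
  superposition needs this uniformity.\<close>

lemma decaying_measures_exist:
  fixes c s t :: real
  assumes two_points: "\<exists>x y :: 'a::complete_space. x \<noteq> y" and "0 < c" "0 < s" "s < t"
    and cover: "\<And>(x :: 'a) r R F. 0 < r \<Longrightarrow> r < R \<Longrightarrow> ereal R < ediameter (UNIV :: 'a set) \<Longrightarrow>
      finite F \<Longrightarrow> cball x R \<subseteq> (\<Union>y\<in>F. cball y r) \<Longrightarrow> c * (r / R) powr (- t) \<le> card F"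
  shows "\<exists>C\<ge>1. \<exists>b :: real \<Rightarrow> real. \<forall>x0 :: 'a. \<exists>M. sets M = sets borel \<and> decays s C M \<and>
    (\<forall>r>0. 0 < emeasure M (cball x0 r)) \<and> (\<forall>x r. emeasure M (cball x r) \<le> ennreal (b r))"
proof -
  note diam = ediameter_pos[OF two_points]
  obtain \<delta> and N :: nat where \<delta>: "0 < \<delta>" "\<delta> \<le> 1/2" "8 * \<delta> < 1" and N: "2 \<le> N" "1 / N \<le> \<delta> powr s"
    and N_le: "N \<le> c * (8 * \<delta>) powr (- t)"
    using scheme_constants[OF assms(2-4)] .
  obtain \<rho> :: real and D :: "real set" and G :: "int \<Rightarrow> bool" where \<rho>: "0 < \<rho>"
    and D: "D \<in> sets borel" "0 \<in> D" "\<And>u. u \<in> D \<Longrightarrow> 0 \<le> u"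
    "\<And>u k. u \<in> D \<Longrightarrow> 1 \<le> u * N powr of_int k \<Longrightarrow> G (k - 1)"
    "\<And>u v k. u \<in> D \<Longrightarrow> G k \<Longrightarrow> 0 \<le> v \<Longrightarrow>
      \<lfloor>v * N powr of_int k\<rfloor> = \<lfloor>u * N powr of_int k\<rfloor> \<Longrightarrow> v \<in> D"
    and G: "\<And>k. G k \<Longrightarrow> ereal (\<rho> * \<delta> powr of_int k) < ediameter (UNIV :: 'a set)"
    "\<And>k. ereal (8 * (\<rho> * \<delta> powr of_int k)) < ediameter (UNIV :: 'a set) \<Longrightarrow> G k"
    by (rule domain_exists[OF diam N(1) \<delta>(1,2)]) (rule that)
  let ?s = "\<lambda>k. \<rho> * \<delta> powr of_int k"
  \<comment> \<open>Separation is demanded at good levels only, so that children exist at every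
    level.\<close>
  define children where "children k p e \<longleftrightarrow> e 0 = p \<and> (\<forall>d<N. dist (e d) p \<le> ?s k) \<and>
    (G k \<longrightarrow> (\<forall>d<N. \<forall>d'<N. d \<noteq> d' \<longrightarrow> 8 * ?s (k + 1) < dist (e d) (e d')))"
    for k and p :: 'a and e :: "nat \<Rightarrow> 'a"
  have "\<exists>e. children k p e" for k p
  proof (cases "G k")
    case True
    have next_scale: "8 * ?s (k + 1) = 8 * \<delta> * ?s k" using \<delta> by (simp add: powr_add)
    have pos: "0 < ?s k" using \<rho> \<delta> by simp
    have next_less: "8 * ?s (k + 1) < ?s k"
      unfolding next_scale using mult_strict_right_mono[OF \<delta>(3) pos] by simp
    have "\<not> cball p (?s k) \<subseteq> (\<Union>y\<in>F. cball y (8 * ?s (k + 1)))"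
      if F: "finite F" "card F < N" for F
    proof
      assume "cball p (?s k) \<subseteq> (\<Union>y\<in>F. cball y (8 * ?s (k + 1)))"
      \<comment> \<open>The ratio of the radii is \<open>8 * \<delta>\<close>, so the covering bound
        demands at least \<open>N\<close> balls.\<close>
      then have "c * (8 * ?s (k + 1) / ?s k) powr (- t) \<le> card F"
        using F(1) G(1)[OF True] \<rho> \<delta> next_less by (intro cover[where x = p]) simp_all
      moreover have "8 * ?s (k + 1) / ?s k = 8 * \<delta>" unfolding next_scale using pos \<rho> by auto
      ultimately show False using N_le F(2) by simp
    qed
    then have "\<exists>e. e 0 = p \<and> (\<forall>d<N. dist (e d) p \<le> ?s k) \<and>
        (\<forall>d<N. \<forall>d'<N. d \<noteq> d' \<longrightarrow> 8 * ?s (k + 1) < dist (e d) (e d'))"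
      using pos N by (intro separated_points) simp_all
    then show ?thesis unfolding children_def by blast
  next
    case False
    then show ?thesis using \<rho> \<delta> by (intro exI[of _ "\<lambda>_. p"]) (auto simp: children_def)
  qed
  then obtain h where "\<And>k p. children k p (h k p)" by metis
  then have h: "\<And>k p. h k p 0 = p"
    "\<And>k p d. d < N \<Longrightarrow> dist (h k p d) p \<le> ?s k"
    "\<And>k p d d'. G k \<Longrightarrow> d < N \<Longrightarrow> d' < N \<Longrightarrow> d \<noteq> d' \<Longrightarrow> 8 * ?s (k + 1) < dist (h k p d) (h k p d')"
    unfolding children_def by blast+
  define C where "C = (4 / \<delta>\<^sup>2) powr s"
  define b where "b r = N powr of_int (- (SOME k. r \<le> 2 * ?s k))" for r
  have "\<exists>M. sets M = sets borel \<and> decays s C M \<and>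
    (\<forall>r>0. 0 < emeasure M (cball x0 r)) \<and> (\<forall>x r. emeasure M (cball x r) \<le> ennreal (b r))" for x0 :: 'a
  proof -
    interpret cantor_scheme N \<delta> \<rho> h x0 G D
      by unfold_locales (fact N \<delta> \<rho> D h)+
    have good: "\<And>k. ereal (8 * scale k) < ediameter (UNIV :: 'a set) \<Longrightarrow> G k"
      unfolding scale_def by (rule G)
    show ?thesis
      using cantor_decay[OF good less_imp_le[OF \<open>0 < s\<close>] N(2)] cantor_pos[OF good diam] cantor_finite
      by (intro exI[of _ cantor_measure]) (simp add: decays_def C_def b_def)
  qed
  moreover have "\<delta>\<^sup>2 \<le> 1" using \<delta> by (simp add: power_le_one)
  then have "1 \<le> C"
    unfolding C_def using \<delta> assms by (intro ge_one_powr_ge_zero) (auto simp: field_simps)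
  ultimately show ?thesis by blast
qed

section \<open>Superposition and passage to outer measures\<close>

text \<open>Written as an integral against counting measure, the sum over \<open>n\<close> commutes
  with the countable sum over the disjoint sets.\<close>

lemma emeasure_mixture:
  fixes M :: "nat \<Rightarrow> 'a::topological_space measure"
  assumes sets: "\<And>n. sets (M n) = sets borel"
  defines "\<nu> \<equiv> \<lambda>A. \<Sum>n. ennreal ((1/2) ^ Suc n) * emeasure (M n) A"
  assumes A: "A \<in> sets borel"
  shows "emeasure (measure_of UNIV (sets borel) \<nu>) A = \<nu> A"
proof (rule emeasure_measure_of_sigma)
  show "sigma_algebra UNIV (sets borel :: 'a set set)"
    using sets.sigma_algebra_axioms[of "borel :: 'a measure"] by simp
  show "positive (sets borel) \<nu>" by (simp add: positive_def \<nu>_def)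
  show "countably_additive (sets borel) \<nu>"
  proof (rule countably_additiveI)
    fix B :: "nat \<Rightarrow> 'a set"
    assume B: "range B \<subseteq> sets borel" "disjoint_family B"
    have "(\<Sum>i. \<nu> (B i)) = (\<Sum>i. \<integral>\<^sup>+ n. ennreal ((1/2) ^ Suc n) * emeasure (M n) (B i) \<partial>count_space UNIV)"
      by (simp add: \<nu>_def nn_integral_count_space_nat)
    also have "\<dots> = (\<integral>\<^sup>+ n. (\<Sum>i. ennreal ((1/2) ^ Suc n) * emeasure (M n) (B i)) \<partial>count_space UNIV)"
      by (rule nn_integral_suminf[symmetric]) simp
    also have "\<dots> = (\<integral>\<^sup>+ n. ennreal ((1/2) ^ Suc n) * emeasure (M n) (\<Union>i. B i) \<partial>count_space UNIV)"
      using B sets by (intro nn_integral_cong) (simp add: suminf_emeasure)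
    finally show "(\<Sum>i. \<nu> (B i)) = \<nu> (\<Union>i. B i)"
      by (simp add: \<nu>_def nn_integral_count_space_nat)
  qed
qed fact

text \<open>The weights sum to 1, so the common bound \<open>b r\<close> survives; positivity on a
  ball comes from a single summand whose centre is near.\<close>

lemma mixture_exists:
  fixes M :: "nat \<Rightarrow> 'a::metric_space measure" and a :: "nat \<Rightarrow> 'a"
  assumes sets: "\<And>n. sets (M n) = sets borel"
    and decays: "\<And>n. decays s C (M n)"
    and pos: "\<And>n r. 0 < r \<Longrightarrow> 0 < emeasure (M n) (cball (a n) r)"
    and fin: "\<And>n x r. emeasure (M n) (cball x r) \<le> ennreal (b r)"
    and dense: "\<And>x r. 0 < r \<Longrightarrow> \<exists>n. dist x (a n) \<le> r"
  shows "\<exists>Q :: 'a measure. sets Q = sets borel \<and> decays s C Q \<and>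
    (\<forall>x r. 0 < r \<longrightarrow> 0 < emeasure Q (cball x r)) \<and> (\<forall>x r. emeasure Q (cball x r) < \<infinity>)"
proof -
  let ?w = "\<lambda>n. ennreal ((1/2) ^ Suc n)"
  define \<nu> where "\<nu> = (\<lambda>A. \<Sum>n. ?w n * emeasure (M n) A)"
  define Q where "Q = measure_of UNIV (sets borel) \<nu>"
  have Q: "emeasure Q A = \<nu> A" if "A \<in> sets borel" for A
    unfolding Q_def \<nu>_def using sets that by (rule emeasure_mixture)
  have "decays s C Q"
    unfolding decays_def
  proof (intro allI impI)
    fix x :: 'a and r R :: real
    assume r: "0 < r" "r < R" "ereal R < ediameter (UNIV :: 'a set)"
    let ?q = "ennreal (C * (r / R) powr s)"
    have "\<nu> (cball x r) \<le> (\<Sum>n. ?q * (?w n * emeasure (M n) (cball x R)))"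
      unfolding \<nu>_def
    proof (intro suminf_le summableI)
      fix n
      have "emeasure (M n) (cball x r) \<le> ?q * emeasure (M n) (cball x R)"
        using decays[of n] r unfolding decays_def by blast
      then have "?w n * emeasure (M n) (cball x r) \<le> ?w n * (?q * emeasure (M n) (cball x R))"
        by (rule mult_left_mono) simp
      then show "?w n * emeasure (M n) (cball x r) \<le> ?q * (?w n * emeasure (M n) (cball x R))"
        by (simp only: mult.left_commute)
    qed
    then show "emeasure Q (cball x r) \<le> ?q * emeasure Q (cball x R)"
      by (simp add: Q \<nu>_def ennreal_suminf_cmult)
  qed
  moreover have "0 < emeasure Q (cball x r)" if "0 < r" for x r
  proof -
    obtain n where n: "dist x (a n) \<le> r / 2" using dense[of "r/2"] \<open>0 < r\<close> by auto
    have "cball (a n) (r / 2) \<subseteq> cball x r"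
    proof
      fix z assume "z \<in> cball (a n) (r / 2)"
      then show "z \<in> cball x r" using n dist_triangle[of x z "a n"] by simp
    qed
    then have "emeasure (M n) (cball (a n) (r / 2)) \<le> emeasure (M n) (cball x r)"
      using sets by (intro emeasure_mono) auto
    then have "0 < emeasure (M n) (cball x r)" using pos[of "r/2" n] \<open>0 < r\<close> by (simp add: less_le_trans)
    then have "0 < ?w n * emeasure (M n) (cball x r)" by (simp add: ennreal_zero_less_mult_iff)
    also have "\<dots> \<le> \<nu> (cball x r)"
      unfolding \<nu>_def using sum_le_suminf[of "\<lambda>n. ?w n * emeasure (M n) (cball x r)" "{n}"] by simp
    finally show ?thesis by (simp add: Q)
  qed
  moreover have "emeasure Q (cball x r) < \<infinity>" for x r
  proof -
    have "emeasure Q (cball x r) \<le> (\<Sum>n. ennreal (b r) * ?w n)"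
      by (simp only: Q borel_closed closed_cball \<nu>_def mult.commute[of "ennreal (b r)"])
        (intro suminf_le summableI mult_left_mono fin, simp)
    also have "\<dots> = ennreal (b r) * (\<Sum>n. ?w n)"
      by (rule ennreal_suminf_cmult)
    also have "(\<Sum>n. ?w n) = ennreal 1"
      by (intro suminf_ennreal_eq power_half_series) simp
    finally show ?thesis by (simp add: le_less_trans)
  qed
  moreover have "sets Q = sets borel"
    unfolding Q_def by (metis sets.sigma_sets_eq sets_measure_of space_borel subset_UNIV Pow_UNIV)
  ultimately show ?thesis by blast
qed

section \<open>The outer measure induced by a Borel measure\<close>

lemma outer_measure_space_outer_measure_of:
  assumes "space M = UNIV"
  shows "outer_measure_space (Pow UNIV) (outer_measure_of M)"
proof -
  have "outer_measure_of M (\<Union>i. A i) \<le> (\<Sum>i. outer_measure_of M (A i))" for A :: "nat \<Rightarrow> 'a set"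
  proof -
    \<comment> \<open>Each set is replaced by a measurable hull of equal measure, where countable
      subadditivity is available.\<close>
    have "\<forall>i. \<exists>E. E \<in> sets M \<and> A i \<subseteq> E \<and> outer_measure_of M (A i) = emeasure M E"
      using outer_measure_of_attain[of "A _" M] assms by (simp add: Bex_def)
    from choice[OF this] obtain E where E: "\<And>i. E i \<in> sets M" "\<And>i. A i \<subseteq> E i"
      "\<And>i. outer_measure_of M (A i) = emeasure M (E i)"
      by auto
    have "outer_measure_of M (\<Union>i. A i) \<le> outer_measure_of M (\<Union>i. E i)"
      using E(2) by (intro outer_measure_of_mono) blast
    also have "\<dots> = emeasure M (\<Union>i. E i)"
      using E(1) by (intro outer_measure_of_eq) auto
    also have "\<dots> \<le> (\<Sum>i. emeasure M (E i))"
      using E(1) by (intro emeasure_subadditive_countably) auto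
    finally show ?thesis by (simp add: E(3))
  qed
  then show ?thesis
    by (simp add: outer_measure_space_def positive_def increasing_def countably_subadditive_def
        outer_measure_of_mono)
qed

text \<open>A measurable hull of \<open>A\<close> is split additively by \<open>l\<close>, which
  bounds the sum of the pieces; hulls of the two pieces give the reverse inequality.\<close>

lemma sets_subset_lambda_system:
  assumes "space M = UNIV"
  shows "sets M \<subseteq> lambda_system UNIV (Pow UNIV) (outer_measure_of M)"
proof -
  have "outer_measure_of M (l \<inter> A) + outer_measure_of M ((UNIV - l) \<inter> A) = outer_measure_of M A"
    if l: "l \<in> sets M" for l A
  proof (rule antisym)
    have compl: "UNIV - l \<in> sets M" using sets.compl_sets[OF l] assms by simp
    obtain E where E: "E \<in> sets M" "A \<subseteq> E" "outer_measure_of M A = emeasure M E"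
      using outer_measure_of_attain[of A M] assms by auto
    have "outer_measure_of M (l \<inter> A) + outer_measure_of M ((UNIV - l) \<inter> A)
        \<le> outer_measure_of M (l \<inter> E) + outer_measure_of M ((UNIV - l) \<inter> E)"
      using E(2) by (intro add_mono outer_measure_of_mono) auto
    also have "\<dots> = emeasure M (l \<inter> E) + emeasure M ((UNIV - l) \<inter> E)"
      using l E(1) compl by (simp add: sets.Int)
    also have "\<dots> = emeasure M ((l \<inter> E) \<union> ((UNIV - l) \<inter> E))"
      using l E(1) compl by (intro plus_emeasure) auto
    also have "(l \<inter> E) \<union> ((UNIV - l) \<inter> E) = E" by auto
    finally show "outer_measure_of M (l \<inter> A) + outer_measure_of M ((UNIV - l) \<inter> A) \<le> outer_measure_of M A"
      by (simp add: E(3))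
    obtain E1 where E1: "E1 \<in> sets M" "l \<inter> A \<subseteq> E1" "outer_measure_of M (l \<inter> A) = emeasure M E1"
      using outer_measure_of_attain[of "l \<inter> A" M] assms by auto
    obtain E2 where E2: "E2 \<in> sets M" "(UNIV - l) \<inter> A \<subseteq> E2"
      "outer_measure_of M ((UNIV - l) \<inter> A) = emeasure M E2"
      using outer_measure_of_attain[of "(UNIV - l) \<inter> A" M] assms by auto
    have "outer_measure_of M A \<le> outer_measure_of M (E1 \<union> E2)"
      using E1(2) E2(2) by (intro outer_measure_of_mono) blast
    also have "\<dots> = emeasure M (E1 \<union> E2)"
      using E1(1) E2(1) by (intro outer_measure_of_eq sets.Un)
    also have "\<dots> \<le> emeasure M E1 + emeasure M E2"
      using E1(1) E2(1) by (rule emeasure_subadditive)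
    finally show "outer_measure_of M A \<le> outer_measure_of M (l \<inter> A) + outer_measure_of M ((UNIV - l) \<inter> A)"
      by (simp add: E1(3) E2(3))
  qed
  then show ?thesis by (auto simp: lambda_system_def)
qed

text \<open>The induced outer measure agrees with \<open>Q\<close> on Borel sets, in particular on
  balls, and hulls provide Borel regularity.\<close>

lemma outer_measure_of_regular:
  fixes Q :: "'a::metric_space measure"
  assumes sets: "sets Q = sets borel" and decays: "decays s C Q" and "1 \<le> C" "0 \<le> s"
    and pos: "\<And>x r. 0 < r \<Longrightarrow> 0 < emeasure Q (cball x r)"
    and fin: "\<And>x r. emeasure Q (cball x r) < \<infinity>"
  shows "metric_measure (outer_measure_of Q)" "fully_supported (outer_measure_of Q)"
    "ereal s \<le> lower_reg_dim (outer_measure_of Q)"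
proof -
  have space: "space Q = UNIV" using sets_eq_imp_space_eq[OF sets] by simp
  have ball: "outer_measure_of Q (cball x r) = emeasure Q (cball x r)" for x r
    using sets by (intro outer_measure_of_eq) auto
  have "\<exists>B\<in>sets borel. A \<subseteq> B \<and> outer_measure_of Q B = outer_measure_of Q A" for A
    using outer_measure_of_attain[of A Q] space sets by (metis outer_measure_of_eq subset_UNIV)
  then have "borel_regular (outer_measure_of Q)"
    unfolding borel_regular_def using sets_subset_lambda_system[OF space] sets by auto
  moreover have "outer_measure_of Q A < \<infinity>" if "bounded A" for A
  proof -
    obtain x r where "A \<subseteq> cball x r" using \<open>bounded A\<close> bounded_subset_cball by blast
    then have "outer_measure_of Q A \<le> outer_measure_of Q (cball x r)" by (rule outer_measure_of_mono)
    then show ?thesis using fin ball by (metis le_less_trans)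
  qed
  moreover have "0 < outer_measure_of Q UNIV"
    using pos[of 1 undefined] ball outer_measure_of_mono[of "cball undefined 1" UNIV Q]
    by (simp add: less_le_trans)
  ultimately show "metric_measure (outer_measure_of Q)"
    using outer_measure_space_outer_measure_of[OF space] by (simp add: metric_measure_def)
  show "fully_supported (outer_measure_of Q)"
    using pos by (simp add: fully_supported_def ball)
  \<comment> \<open>The larger ball has positive mass, so the inequality in \<open>decays\<close>
    may be divided by it.\<close>
  have "outer_measure_of Q (cball x r) / outer_measure_of Q (cball x R) \<le> ennreal (C * (r / R) powr s)"
    if "0 < r" "r < R" "ereal R < ediameter (UNIV :: 'a set)" for x r R
    using that decays pos[of R x] unfolding ball decays_def
    by (intro divide_le_posI_ennreal) (auto simp: mult.commute)
  then show "ereal s \<le> lower_reg_dim (outer_measure_of Q)"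
    unfolding lower_reg_dim_def using assms(3,4) by (intro Sup_upper) blast
qed

text \<open>Iterated doubling covers any ball by finitely many balls of any smaller radius. The
  centres obtained for radii \<open>1 / Suc m\<close> and growing balls about a fixed point form a
  countable dense set.\<close>

lemma doubling_dense_sequence:
  assumes "finite_doubling TYPE('a::metric_space)"
  obtains a :: "nat \<Rightarrow> 'a::metric_space" where "\<And>x r. 0 < r \<Longrightarrow> \<exists>n. dist x (a n) \<le> r"
proof -
  have cover: "\<exists>F. finite F \<and> cball x (2 ^ n * r) \<subseteq> (\<Union>y\<in>F. cball y r)" if "0 < r" for x :: 'a and n r
  proof (induction n arbitrary: x)
    case 0
    show ?case by (intro exI[of _ "{x}"]) auto
  next
    case (Suc n)
    obtain F where F: "finite F" "cball x (2 * (2 ^ n * r)) \<subseteq> (\<Union>y\<in>F. cball y (2 ^ n * r))"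
      using assms[unfolded finite_doubling_def, rule_format, of "2 ^ n * r" x] \<open>0 < r\<close> by auto
    obtain H :: "'a \<Rightarrow> 'a set" where H: "\<And>y. finite (H y)" "\<And>y. cball y (2 ^ n * r) \<subseteq> (\<Union>z\<in>H y. cball z r)"
      using Suc by metis
    have "cball x (2 ^ Suc n * r) \<subseteq> (\<Union>z\<in>(\<Union>y\<in>F. H y). cball z r)"
    proof
      fix w assume "w \<in> cball x (2 ^ Suc n * r)"
      then have "w \<in> (\<Union>y\<in>F. cball y (2 ^ n * r))"
        by (intro subsetD[OF F(2)]) (simp add: mult.assoc)
      then obtain y where y: "y \<in> F" "w \<in> cball y (2 ^ n * r)" by (rule UN_E)
      then obtain z where "z \<in> H y" "w \<in> cball z r"
        using subsetD[OF H(2) y(2)] by (elim UN_E)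
      then show "w \<in> (\<Union>z\<in>(\<Union>y\<in>F. H y). cball z r)" using y(1) by (intro UN_I)
    qed
    then show ?case using F(1) H(1) by (intro exI[of _ "\<Union>y\<in>F. H y"] conjI finite_UN_I)
  qed
  have "\<exists>F. finite F \<and> cball x (2 ^ n * (1 / Suc m)) \<subseteq> (\<Union>y\<in>F. cball y (1 / Suc m))" for x :: 'a and n m
    by (rule cover) simp
  then obtain F :: "nat \<Rightarrow> nat \<Rightarrow> 'a set" where F: "\<And>n m. finite (F n m)"
    "\<And>n m. cball undefined (2 ^ n * (1 / Suc m)) \<subseteq> (\<Union>y\<in>F n m. cball y (1 / Suc m))"
    by metis
  define S where "S = insert undefined (\<Union>n m. F n m)"
  have S: "countable S" "S \<noteq> {}"
    unfolding S_def using countable_finite[OF F(1)] by auto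
  have "\<exists>n. dist x (from_nat_into S n) \<le> r" if "0 < r" for x r
  proof -
    obtain m where m: "1 / Suc m < r" using \<open>0 < r\<close> nat_approx_posE by metis
    obtain n where "dist undefined x * Suc m < 2 ^ n"
      using real_arch_pow[of 2] by auto
    then have "x \<in> cball undefined (2 ^ n * (1 / Suc m))"
      by (simp add: field_simps)
    from subsetD[OF F(2) this] obtain y where "y \<in> F n m" "x \<in> cball y (1 / Suc m)" by (rule UN_E)
    then have "y \<in> S" "dist x y \<le> r" using m unfolding S_def by (auto simp: dist_commute)
    then show ?thesis using from_nat_into_surj[OF S(1)] by metis
  qed
  then show ?thesis using that by blast
qed

lemma regular_measure_exists:
  fixes M :: "'a::metric_space \<Rightarrow> 'a measure"
  assumes "finite_doubling TYPE('a)" "1 \<le> C" "0 \<le> s"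
    and "\<And>x. sets (M x) = sets borel" "\<And>x. decays s C (M x)"
    and "\<And>x r. 0 < r \<Longrightarrow> 0 < emeasure (M x) (cball x r)"
    and "\<And>x y r. emeasure (M x) (cball y r) \<le> ennreal (b r)"
  shows "\<exists>\<mu> :: 'a set \<Rightarrow> ennreal. metric_measure \<mu> \<and> fully_supported \<mu> \<and> ereal s \<le> lower_reg_dim \<mu>"
proof -
  obtain a :: "nat \<Rightarrow> 'a" where a: "\<And>x r. 0 < r \<Longrightarrow> \<exists>n. dist x (a n) \<le> r"
    using doubling_dense_sequence[OF assms(1)] by blast
  obtain Q :: "'a measure" where Q: "sets Q = sets borel" "decays s C Q"
    "\<And>x r. 0 < r \<Longrightarrow> 0 < emeasure Q (cball x r)" "\<And>x r. emeasure Q (cball x r) < \<infinity>"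
    using mixture_exists[of "\<lambda>n. M (a n)", OF assms(4-7) a] by blast
  then show ?thesis using outer_measure_of_regular[OF Q(1,2) assms(2,3) Q(3,4)] by blast
qed

text \<open>With exponent 0 and constant 1, decay is mere monotonicity in the radius, so Dirac
  masses can be superposed.\<close>

lemma regular_measure_dim_0:
  assumes "finite_doubling TYPE('a::metric_space)"
  shows "\<exists>\<mu> :: 'a::metric_space set \<Rightarrow> ennreal. metric_measure \<mu> \<and> fully_supported \<mu> \<and> 0 \<le> lower_reg_dim \<mu>"
proof -
  define dirac where "dirac x = distr (count_space (UNIV :: unit set)) borel (\<lambda>_. x)" for x :: 'a
  have "emeasure (dirac x) (cball y r) = (if dist y x \<le> r then 1 else 0)" for x y r
    by (simp add: dirac_def emeasure_distr)
  moreover from this have "decays 0 1 (dirac x)" for x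
    by (auto simp: decays_def)
  moreover have "sets (dirac x) = sets borel" for x by (simp add: dirac_def)
  ultimately show ?thesis
    using regular_measure_exists[OF assms, of 1 0 dirac "\<lambda>_. 1"]
    by (simp add: zero_ereal_def)
qed

text \<open>Three exponents \<open>q < s < t\<close>: \<open>t\<close> governs covers and
  \<open>s\<close> the measure. The gap \<open>s < t\<close> is spent on the constants of the
  scheme, the gap \<open>q < s\<close> on strictness.\<close>

lemma regular_measure_below_lower_dim:
  assumes two_points: "\<exists>x y :: 'a::complete_space. x \<noteq> y"
    and doubling: "finite_doubling TYPE('a::complete_space)"
    and q: "0 \<le> q" "ereal q < lower_dim TYPE('a)"
  shows "\<exists>\<mu> :: 'a set \<Rightarrow> ennreal. metric_measure \<mu> \<and> fully_supported \<mu> \<and> ereal q < lower_reg_dim \<mu>"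
proof -
  obtain t c where t: "q < t" "0 < c" and
    c: "\<forall>(x :: 'a) r R. 0 < r \<longrightarrow> r < R \<longrightarrow> ereal R < ediameter (UNIV :: 'a set) \<longrightarrow>
      (\<forall>F. finite F \<longrightarrow> cball x R \<subseteq> (\<Union>y\<in>F. cball y r) \<longrightarrow> c * (r / R) powr (- t) \<le> real (card F))"
    using q(2) unfolding lower_dim_def less_Sup_iff by auto
  obtain s where s: "q < s" "s < t" using dense[OF t(1)] by blast
  have "0 < s" using s q(1) by simp
  have "\<exists>C\<ge>1. \<exists>b :: real \<Rightarrow> real. \<forall>x0 :: 'a. \<exists>M. sets M = sets borel \<and> decays s C M \<and>
    (\<forall>r>0. 0 < emeasure M (cball x0 r)) \<and> (\<forall>x r. emeasure M (cball x r) \<le> ennreal (b r))"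
    by (rule decaying_measures_exist[OF two_points t(2) \<open>0 < s\<close> s(2)]) (use c in blast)
  then obtain C b where "1 \<le> C" and ex: "\<forall>x0 :: 'a. \<exists>M. sets M = sets borel \<and> decays s C M \<and>
    (\<forall>r>0. 0 < emeasure M (cball x0 r)) \<and> (\<forall>x r. emeasure M (cball x r) \<le> ennreal (b r))"
    by (elim exE conjE)
  obtain M where M: "\<forall>x0 :: 'a. sets (M x0) = sets borel \<and> decays s C (M x0) \<and>
    (\<forall>r>0. 0 < emeasure (M x0) (cball x0 r)) \<and> (\<forall>x r. emeasure (M x0) (cball x r) \<le> ennreal (b r))"
    using choice[OF ex] by (elim exE)
  obtain \<mu> :: "'a set \<Rightarrow> ennreal" where "metric_measure \<mu>" "fully_supported \<mu>" "ereal s \<le> lower_reg_dim \<mu>"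
    using regular_measure_exists[OF doubling \<open>1 \<le> C\<close>, of s M b] M s q(1) by auto
  moreover have "ereal q < ereal s" using s by simp
  ultimately show ?thesis by (metis less_le_trans)
qed

theorem theorem3p2:
  assumes two_points: "\<exists>x y :: 'a::complete_space. x \<noteq> y"
    and perfect: "uniformly_perfect TYPE('a)"
    and doubling: "finite_doubling TYPE('a)"
  shows "(lower_dim TYPE('a) \<noteq> \<infinity> \<longrightarrow>
            (\<forall>\<epsilon>>0. \<exists>\<mu> :: 'a set \<Rightarrow> ennreal. metric_measure \<mu> \<and> fully_supported \<mu> \<and>
              lower_reg_dim \<mu> > lower_dim TYPE('a) - ereal \<epsilon>)) \<and>
         (lower_dim TYPE('a) = \<infinity> \<longrightarrow>
            (\<forall>t\<ge>0. \<exists>\<mu> :: 'a set \<Rightarrow> ennreal. metric_measure \<mu> \<and> fully_supported \<mu> \<and>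
              lower_reg_dim \<mu> > ereal t))"
proof (intro conjI impI allI)
  fix \<epsilon> :: real
  assume fin: "lower_dim TYPE('a) \<noteq> \<infinity>" and \<epsilon>: "0 < \<epsilon>"
  show "\<exists>\<mu> :: 'a set \<Rightarrow> ennreal. metric_measure \<mu> \<and> fully_supported \<mu> \<and>
    lower_reg_dim \<mu> > lower_dim TYPE('a) - ereal \<epsilon>"
  proof (cases "0 < lower_dim TYPE('a)")
    case True
    then obtain D where D: "lower_dim TYPE('a) = ereal D" "0 < D"
      using fin by (cases "lower_dim TYPE('a)") auto
    \<comment> \<open>The maximum keeps the exponent nonnegative when \<epsilon> exceeds the
      dimension.\<close>
    have "ereal (max 0 (D - \<epsilon>)) < lower_dim TYPE('a)" using D \<epsilon> by simp
    then obtain \<mu> :: "'a set \<Rightarrow> ennreal" where \<mu>: "metric_measure \<mu>" "fully_supported \<mu>"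
      "ereal (max 0 (D - \<epsilon>)) < lower_reg_dim \<mu>"
      using regular_measure_below_lower_dim[OF two_points doubling, of "max 0 (D - \<epsilon>)"] by auto
    have "lower_dim TYPE('a) - ereal \<epsilon> \<le> ereal (max 0 (D - \<epsilon>))" using D by simp
    then show ?thesis using \<mu> le_less_trans by blast
  next
    case False
    \<comment> \<open>The target is negative, so nonnegative regularity dimension suffices.\<close>
    then have "lower_dim TYPE('a) - ereal \<epsilon> < 0"
      using \<epsilon> by (cases "lower_dim TYPE('a)") auto
    then show ?thesis using regular_measure_dim_0[OF doubling] by (metis less_le_trans)
  qed
next
  fix t :: real
  assume "lower_dim TYPE('a) = \<infinity>" "0 \<le> t"
  then show "\<exists>\<mu> :: 'a set \<Rightarrow> ennreal. metric_measure \<mu> \<and> fully_supported \<mu> \<and> lower_reg_dim \<mu> > ereal t"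
    using regular_measure_below_lower_dim[OF two_points doubling] by simp
qed

end
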